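(* Let $0<c_1\le c_2<\infty$ be constants. For each integer $M\ge 3$, let $\gamma_1,\dots,\gamma_{2M}$ be real numbers (possibly depending on $M$) with $c_1\le \gamma_i\le c_2$ for all $i$, and let $h_{i,m}$, $1\le i\le 2M$, $1\le m\le M$, be i.i.d. circularly symmetric complex Gaussian random variables $\mathcal{CN}(0,1)$. For distinct users $i,j\in\{1,\dots,2M\}$ and $m\in\{1,\dots,M\}$ put $$R_m(i,j)=\log_2\left(1+\gamma_i|h_{i,m}|^2+\gamma_j|h_{j,m}|^2\right).$$ Let $\Pi$ be the set of all pairings, i.e. all assignments $m\mapsto (\ell_{2m-1},\ell_{2m})$, $m=1,\dots,M$, such that $(\ell_1,\dots,\ell_{2M})$ is a permutation of $(1,\dots,2M)$. Then, as $M\to\infty$, $$\frac{\max_{\Pi}\sum_{m=1}^M R_m(\ell_{2m-1},\ell_{2m})}{M\log_2\log M}\longrightarrow 1\quad\text{in probability}.$$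
   Context: Setting: $2M$ single-antenna users send to a single-antenna base station over $M$ subcarriers; each subcarrier is assigned to exactly two users, each user being assigned to exactly one subcarrier. $h_{i,m}$ is the small-scale fading coefficient of user $i$ on subcarrier $m$, $\gamma_i$ is the receive SNR of user $i$, and $R_m(i,j)$ is the sum rate on subcarrier $m$ if it is assigned to users $i$ and $j$. $\log$ is the natural logarithm and $\log_2$ the base-2 logarithm. *)

theory Defs
  imports "HOL-Probability.Probability" "HOL-Combinatorics.Permutations"
begin

(* CN(0,1): independent real and imaginary parts, each N(0,1/2), so that E|Z|^2 = 1.
   normal_density is parametrised by the standard deviation. *)
definition std_complex_gaussian :: "'a measure \<Rightarrow> ('a \<Rightarrow> complex) \<Rightarrow> bool" where
  "std_complex_gaussian P Z \<longleftrightarrow>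
     Z \<in> borel_measurable P \<and>
     prob_space.indep_var P borel (\<lambda>\<omega>. Re (Z \<omega>)) borel (\<lambda>\<omega>. Im (Z \<omega>)) \<and>
     distributed P lborel (\<lambda>\<omega>. Re (Z \<omega>)) (normal_density 0 (sqrt (1 / 2))) \<and>
     distributed P lborel (\<lambda>\<omega>. Im (Z \<omega>)) (normal_density 0 (sqrt (1 / 2)))"

definition subcarrier_rate ::
  "(nat \<Rightarrow> real) \<Rightarrow> (nat \<Rightarrow> nat \<Rightarrow> complex) \<Rightarrow> nat \<Rightarrow> nat \<Rightarrow> nat \<Rightarrow> real" where
  "subcarrier_rate \<gamma> h m i j =
     log 2 (1 + \<gamma> i * (cmod (h i m))\<^sup>2 + \<gamma> j * (cmod (h j m))\<^sup>2)"

definition pairings :: "nat \<Rightarrow> (nat \<Rightarrow> nat) set" where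
  "pairings M = {l. l permutes {1..2 * M}}"

definition max_sum_rate :: "nat \<Rightarrow> (nat \<Rightarrow> real) \<Rightarrow> (nat \<Rightarrow> nat \<Rightarrow> complex) \<Rightarrow> real" where
  "max_sum_rate M \<gamma> h =
     Max ((\<lambda>l. \<Sum>m = 1..M. subcarrier_rate \<gamma> h m (l (2 * m - 1)) (l (2 * m))) ` pairings M)"

(* Convergence in probability to a constant; the n-th variable lives on its own space P n. *)
definition tendsto_in_prob ::
  "(nat \<Rightarrow> 'a measure) \<Rightarrow> (nat \<Rightarrow> 'a \<Rightarrow> real) \<Rightarrow> real \<Rightarrow> bool" where
  "tendsto_in_prob P X c \<longleftrightarrow>
     (\<forall>\<epsilon>>0. (\<lambda>n. measure (P n) {\<omega> \<in> space (P n). \<bar>X n \<omega> - c\<bar> > \<epsilon>}) \<longlonglongrightarrow> 0)"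

lemma finite_pairings: "finite (pairings M)"
  unfolding pairings_def by (rule finite_permutations) simp

lemma pairings_nonempty: "pairings M \<noteq> {}"
  unfolding pairings_def using permutes_id by blast

(* The events measured in tendsto_in_prob are measurable for the maximal sum rate. *)
lemma max_sum_rate_measurable:
  assumes "\<And>i m. \<lbrakk>i \<in> {1..2 * M}; m \<in> {1..M}\<rbrakk> \<Longrightarrow> h i m \<in> borel_measurable P"
  shows "(\<lambda>\<omega>. max_sum_rate M \<gamma> (\<lambda>i m. h i m \<omega>)) \<in> borel_measurable P"
proof -
  have "(\<lambda>\<omega>. \<Sum>m = 1..M. subcarrier_rate \<gamma> (\<lambda>i m. h i m \<omega>) m (l (2 * m - 1)) (l (2 * m)))
          \<in> borel_measurable P" if "l \<in> pairings M" for l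
  proof (rule borel_measurable_sum)
    fix m assume m: "m \<in> {1..M}"
    then have "2 * m - 1 \<in> {1..2 * M}" "2 * m \<in> {1..2 * M}" by auto
    then have "l (2 * m - 1) \<in> {1..2 * M}" "l (2 * m) \<in> {1..2 * M}"
      using that unfolding pairings_def by (metis mem_Collect_eq permutes_in_image)+
    then have [measurable]: "h (l (2 * m - 1)) m \<in> borel_measurable P"
      "h (l (2 * m)) m \<in> borel_measurable P"
      using assms m by blast+
    show "(\<lambda>\<omega>. subcarrier_rate \<gamma> (\<lambda>i m. h i m \<omega>) m (l (2 * m - 1)) (l (2 * m)))
            \<in> borel_measurable P"
      unfolding subcarrier_rate_def by measurable
  qed
  then show ?thesis
    unfolding max_sum_rate_def
    by (intro borel_measurable_Max finite_pairings) auto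
qed

end

theory Submission
  imports Defs "HOL-Real_Asymp.Real_Asymp"
begin

text \<open>
  Only the double logarithm of the number of subcarriers matters, so crude tails of the squared
  fading coefficients suffice. Upper bound: by a union bound, all \<open>2M\<^sup>2\<close> of them are at most
  \<open>16 ln M\<close> with high probability, so every rate is at most \<open>log\<^sub>2 (1 + 32 c\<^sub>2 ln M)\<close>.
  Lower bound: it is enough that each subcarrier gets one user with squared coefficient at least
  \<open>ln M / 4\<close>; the other user is arbitrary. Assigning greedily, each subcarrier still has at least
  \<open>M\<close> free users, each of them good with probability at least a constant times \<open>1 / sqrt M\<close>, so
  some step fails with probability at most \<open>M exp (- c sqrt M)\<close>.
\<close>

section \<open>Greedy matching in a random bipartite graph\<close>

text \<open>A matching that saturates the columns \<open>1..k\<close> of a bipartite graph. The edge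
  set is a plain argument, not a random object, so that the graph can later be split into finitely
  many fixed patterns.\<close>

definition matchable :: "'u set \<Rightarrow> nat \<Rightarrow> ('u \<times> nat) set \<Rightarrow> bool" where
  "matchable I k A \<longleftrightarrow> (\<exists>f. inj_on f {1..k} \<and> f ` {1..k} \<subseteq> I \<and> (\<forall>m\<in>{1..k}. (f m, m) \<in> A))"

lemma matchable_Suc:
  assumes "inj_on f {1..k}" "f ` {1..k} \<subseteq> I" "\<forall>m\<in>{1..k}. (f m, m) \<in> A"
    and "i \<in> I - f ` {1..k}" "(i, Suc k) \<in> A"
  shows "matchable I (Suc k) A"
proof -
  let ?g = "f(Suc k := i)"
  have eq: "{1..Suc k} = insert (Suc k) {1..k}" by auto
  have im: "?g ` {1..k} = f ` {1..k}" by (intro image_cong) auto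
  have "inj_on ?g {1..k}" using assms(1) by (subst inj_on_cong[where g = f]) auto
  then have "inj_on ?g {1..Suc k}"
    unfolding eq using assms(4) im by (simp add: inj_on_insert)
  moreover have "?g ` {1..Suc k} \<subseteq> I" unfolding eq using assms(2,4) im by auto
  moreover have "\<forall>m\<in>{1..Suc k}. (?g m, m) \<in> A" unfolding eq using assms(3,5) by auto
  ultimately show ?thesis unfolding matchable_def by blast
qed

text \<open>Product rule in comprehension form. The empty index set is treated apart because
  \<open>indep_varsD\<close> asks for a nonempty one.\<close>

lemma (in prob_space) indep_vars_prob_Ball:
  assumes ind: "indep_vars (\<lambda>_. count_space UNIV) G I" and J: "finite J" "J \<subseteq> I"
  shows "prob {\<omega> \<in> space M. \<forall>x\<in>J. G x \<omega> \<in> B x} = (\<Prod>x\<in>J. prob {\<omega> \<in> space M. G x \<omega> \<in> B x})"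
proof (cases "J = {}")
  case True
  then show ?thesis by (simp add: prob_space)
next
  case False
  have "{\<omega> \<in> space M. \<forall>x\<in>J. G x \<omega> \<in> B x} = (\<Inter>x\<in>J. G x -` B x \<inter> space M)"
    using False by auto
  moreover have "{\<omega> \<in> space M. G x \<omega> \<in> B x} = G x -` B x \<inter> space M" for x by auto
  ultimately show ?thesis
    using indep_varsD[OF ind False J, of B] by simp
qed

text \<open>Greedy matching: conditionally on the edges at the first \<open>k\<close> columns, which fix a matching
  of them, column \<open>k + 1\<close> has at least \<open>n\<close> unused candidates with fresh independent edges.\<close>

lemma (in prob_space) prob_not_matchable:
  fixes G :: "'u \<times> nat \<Rightarrow> 'a \<Rightarrow> bool"
  assumes I: "finite I" "card I \<ge> K + n"
    and ind: "indep_vars (\<lambda>_. count_space UNIV) G (I \<times> {1..K})"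
    and q: "q \<le> 1" "\<And>x. x \<in> I \<times> {1..K} \<Longrightarrow> prob {\<omega> \<in> space M. \<not> G x \<omega>} \<le> q"
    and k: "k \<le> K"
  shows "{\<omega> \<in> space M. \<not> matchable I k {x \<in> I \<times> {1..k}. G x \<omega>}} \<in> events \<and>
    prob {\<omega> \<in> space M. \<not> matchable I k {x \<in> I \<times> {1..k}. G x \<omega>}} \<le> k * q ^ n"
  using k
proof (induction k)
  case 0
  have "matchable I 0 A" for A unfolding matchable_def by auto
  then show ?case by simp
next
  case (Suc k)
  define Pat where "Pat k \<omega> = {x \<in> I \<times> {1..k}. G x \<omega>}" for k :: nat and \<omega>
  define Bad where "Bad k = {\<omega> \<in> space M. \<not> matchable I k (Pat k \<omega>)}" for k
  define E where "E k a = {\<omega> \<in> space M. Pat k \<omega> = a}" for k a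
  have meas: "G x \<in> measurable M (count_space UNIV)" if "x \<in> I \<times> {1..K}" for x
    using ind that unfolding indep_vars_def by blast
  have Ball_events: "{\<omega> \<in> space M. \<forall>x\<in>J. G x \<omega> \<in> B x} \<in> events"
    if "J \<subseteq> I \<times> {1..K}" for J B
  proof -
    have "finite J" using that I finite_subset by blast
    moreover have "{\<omega> \<in> space M. G x \<omega> \<in> B x} \<in> events" if "x \<in> J" for x
      using measurable_sets[OF meas, of x "B x"] that \<open>J \<subseteq> _\<close>
      by (auto simp: vimage_def Int_def conj_commute)
    ultimately show ?thesis by (intro sets.sets_Collect_finite_All) auto
  qed
  have E_eq: "E k a = {\<omega> \<in> space M. \<forall>x\<in>I \<times> {1..k}. G x \<omega> \<in> {x \<in> a}}"
    if "a \<subseteq> I \<times> {1..k}" for k a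
    using that unfolding E_def Pat_def by auto
  have E_events: "E k a \<in> events" if "a \<subseteq> I \<times> {1..k}" "k \<le> K" for k a
    unfolding E_eq[OF that(1)] using that by (intro Ball_events) auto
  have fin: "finite (Pow (I \<times> {1..k}))" for k :: nat using I by simp
  have Bad_events: "Bad k \<in> events" if "k \<le> K" for k
  proof -
    have "Bad k = (\<Union>a\<in>{a \<in> Pow (I \<times> {1..k}). \<not> matchable I k a}. E k a)"
      unfolding Bad_def E_def Pat_def by auto
    then show ?thesis using fin[of k] E_events that by auto
  qed
  \<comment> \<open>Nonnegativity of \<open>q\<close> is read off from a single edge; a user exists
    because \<open>card I\<close> is at least \<open>K\<close>, hence positive.\<close>
  obtain i where "i \<in> I" using I Suc.prems by fastforce
  then have "prob {\<omega> \<in> space M. \<not> G (i, Suc k) \<omega>} \<le> q" using q(2) Suc.prems by auto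
  then have q0: "0 \<le> q" using measure_nonneg order_trans by blast
  define A where "A = {a \<in> Pow (I \<times> {1..k}). matchable I k a}"
  have "\<forall>a\<in>A. \<exists>f. inj_on f {1..k} \<and> f ` {1..k} \<subseteq> I \<and> (\<forall>m\<in>{1..k}. (f m, m) \<in> a)"
    unfolding A_def matchable_def by blast
  then obtain f where f: "\<And>a. a \<in> A \<Longrightarrow> inj_on (f a) {1..k}"
    "\<And>a. a \<in> A \<Longrightarrow> f a ` {1..k} \<subseteq> I" "\<And>a. a \<in> A \<Longrightarrow> \<forall>m\<in>{1..k}. (f a m, m) \<in> a"
    by metis
  define J where "J a = (I - f a ` {1..k}) \<times> {Suc k}" for a
  define F where "F a = {\<omega> \<in> space M. \<forall>x\<in>J a. G x \<omega> \<in> {False}}" for a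
  have J: "J a \<subseteq> I \<times> {1..K}" "finite (J a)" "(I \<times> {1..k}) \<inter> J a = {}" for a
    using Suc.prems I unfolding J_def by auto
  have cardJ: "card (J a) \<ge> n" if "a \<in> A" for a
  proof -
    have "card (J a) = card I - card (f a ` {1..k})"
      unfolding J_def using f(2)[OF that] I by (simp add: card_cartesian_product card_Diff_subset finite_subset)
    also have "card (f a ` {1..k}) = k" using f(1)[OF that] by (simp add: card_image)
    finally show ?thesis using I Suc.prems by simp
  qed
  have F_events: "F a \<in> events" for a unfolding F_def using J by (intro Ball_events)
  have probEF: "prob (E k a \<inter> F a) \<le> prob (E k a) * q ^ n" if a: "a \<in> A" for a
  proof -
    have a': "a \<subseteq> I \<times> {1..k}" using a unfolding A_def by auto
    \<comment> \<open>One family of target sets describes both events, so the product rule applies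
      to the disjoint union of old and fresh edges. The factor over the old edges is then folded
      back into \<open>prob (E k a)\<close>.\<close>
    define B where "B x = (if x \<in> I \<times> {1..k} then {x \<in> a} else {False})" for x
    have "E k a \<inter> F a = {\<omega> \<in> space M. \<forall>x\<in>(I \<times> {1..k}) \<union> J a. G x \<omega> \<in> B x}"
      unfolding E_eq[OF a'] F_def B_def using J(3)[of a] by (auto simp: ball_Un)
    also have "prob \<dots> = (\<Prod>x\<in>(I \<times> {1..k}) \<union> J a. prob {\<omega> \<in> space M. G x \<omega> \<in> B x})"
      using J I Suc.prems by (intro indep_vars_prob_Ball[OF ind]) auto
    also have "\<dots> = (\<Prod>x\<in>I \<times> {1..k}. prob {\<omega> \<in> space M. G x \<omega> \<in> B x})
                     * (\<Prod>x\<in>J a. prob {\<omega> \<in> space M. G x \<omega> \<in> B x})"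
      using J I by (intro prod.union_disjoint) auto
    also have "(\<Prod>x\<in>I \<times> {1..k}. prob {\<omega> \<in> space M. G x \<omega> \<in> B x})
        = (\<Prod>x\<in>I \<times> {1..k}. prob {\<omega> \<in> space M. G x \<omega> \<in> {x \<in> a}})"
      unfolding B_def by (intro prod.cong) auto
    also have "\<dots> = prob (E k a)"
      unfolding E_eq[OF a'] using I Suc.prems
      by (intro indep_vars_prob_Ball[OF ind, symmetric]) auto
    also have "(\<Prod>x\<in>J a. prob {\<omega> \<in> space M. G x \<omega> \<in> B x}) \<le> (\<Prod>x\<in>J a. q)"
    proof (intro prod_mono conjI measure_nonneg)
      fix x assume x: "x \<in> J a"
      then have "x \<notin> I \<times> {1..k}" "x \<in> I \<times> {1..K}" using J by blast+
      then show "prob {\<omega> \<in> space M. G x \<omega> \<in> B x} \<le> q"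
        unfolding B_def using q(2)[of x] by simp
    qed
    also have "(\<Prod>x\<in>J a. q) = q ^ card (J a)" by simp
    also have "\<dots> \<le> q ^ n" using cardJ[OF a] q0 q(1) by (intro power_decreasing) auto
    finally show ?thesis by (simp add: mult_left_mono)
  qed
  have finA: "finite A" using fin[of k] unfolding A_def by simp
  have EA: "E k a \<in> events" if "a \<in> A" for a
    using that Suc.prems unfolding A_def by (intro E_events) auto
  \<comment> \<open>Distinct patterns exclude each other, so summing over them costs no factor
    \<open>card A\<close>.\<close>
  have sumE: "(\<Sum>a\<in>A. prob (E k a)) \<le> 1"
  proof -
    have "(\<Sum>a\<in>A. prob (E k a)) = prob (\<Union>a\<in>A. E k a)"
      using finA EA by (intro finite_measure_finite_Union[symmetric])
        (auto simp: disjoint_family_on_def E_def)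
    then show ?thesis by simp
  qed
  have EF_events: "(\<Union>a\<in>A. E k a \<inter> F a) \<in> events"
    using EA F_events finA by (intro sets.finite_UN sets.Int) auto
  have "Bad (Suc k) \<subseteq> Bad k \<union> (\<Union>a\<in>A. E k a \<inter> F a)"
  proof
    fix \<omega> assume \<omega>: "\<omega> \<in> Bad (Suc k)"
    then have sp: "\<omega> \<in> space M" and nm: "\<not> matchable I (Suc k) (Pat (Suc k) \<omega>)"
      unfolding Bad_def by auto
    show "\<omega> \<in> Bad k \<union> (\<Union>a\<in>A. E k a \<inter> F a)"
    proof (cases "matchable I k (Pat k \<omega>)")
      case False
      then show ?thesis using sp unfolding Bad_def by simp
    next
      case True
      define a where "a = Pat k \<omega>"
      have a: "a \<in> A" unfolding A_def a_def using True by (auto simp: Pat_def)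
      have sub: "a \<subseteq> Pat (Suc k) \<omega>" unfolding a_def Pat_def by auto
      have "\<not> G x \<omega>" if "x \<in> J a" for x
      proof
        assume G: "G x \<omega>"
        obtain i where i: "x = (i, Suc k)" "i \<in> I - f a ` {1..k}" using \<open>x \<in> J a\<close> unfolding J_def by auto
        have "(i, Suc k) \<in> Pat (Suc k) \<omega>" unfolding Pat_def using G i by auto
        moreover have "\<forall>m\<in>{1..k}. (f a m, m) \<in> Pat (Suc k) \<omega>" using f(3)[OF a] sub by blast
        ultimately show False
          using matchable_Suc[OF f(1)[OF a] f(2)[OF a] _ i(2)] nm by blast
      qed
      then have "\<omega> \<in> E k a \<inter> F a" unfolding E_def F_def using sp a_def by auto
      then show ?thesis using a by blast
    qed
  qed
  then have "prob (Bad (Suc k)) \<le> prob (Bad k \<union> (\<Union>a\<in>A. E k a \<inter> F a))"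
    using Bad_events[of k] Suc.prems EF_events by (intro finite_measure_mono) auto
  also have "\<dots> \<le> prob (Bad k) + prob (\<Union>a\<in>A. E k a \<inter> F a)"
    using Bad_events[of k] Suc.prems EF_events by (intro measure_Un_le) auto
  also have "prob (\<Union>a\<in>A. E k a \<inter> F a) \<le> (\<Sum>a\<in>A. prob (E k a \<inter> F a))"
    using finA EA F_events by (intro measure_UNION_le) auto
  also have "\<dots> \<le> (\<Sum>a\<in>A. prob (E k a) * q ^ n)" by (intro sum_mono probEF)
  also have "\<dots> = (\<Sum>a\<in>A. prob (E k a)) * q ^ n" by (simp add: sum_distrib_right)
  also have "\<dots> \<le> 1 * q ^ n" using sumE q0 by (intro mult_right_mono) auto
  also have "prob (Bad k) \<le> k * q ^ n" using Suc unfolding Bad_def Pat_def by simp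
  finally have "prob (Bad (Suc k)) \<le> Suc k * q ^ n" by (simp add: algebra_simps)
  then show ?case using Bad_events[OF Suc.prems] unfolding Bad_def Pat_def by blast
qed
section \<open>Tails of the fading coefficients\<close>

text \<open>The density \<open>exp (- x\<^sup>2) / sqrt pi\<close> is
  \<open>sqrt 2 * exp (- x\<^sup>2 / 2)\<close> times the standard normal density. Half of the
  exponent gives the decay on the tail, the other half integrates to 1.\<close>

lemma (in prob_space) normal_variance_half_upper_tail:
  assumes D: "distributed M lborel X (normal_density 0 (sqrt (1 / 2)))"
  shows "prob {\<omega> \<in> space M. s < (X \<omega>)\<^sup>2} \<le> sqrt 2 * exp (- s / 2)"
proof -
  let ?A = "{x::real. s < x\<^sup>2}"
  have [measurable]: "?A \<in> sets borel" by measurable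
  have le: "normal_density 0 (sqrt (1 / 2)) x * indicator ?A x
      \<le> sqrt 2 * exp (- s / 2) * normal_density 0 1 x" for x
  proof (cases "s < x\<^sup>2")
    case True
    have "normal_density 0 (sqrt (1 / 2)) x = sqrt 2 * exp (- x\<^sup>2 / 2) * normal_density 0 1 x"
      by (simp add: normal_density_def real_sqrt_mult field_simps flip: exp_add)
    also have "\<dots> \<le> sqrt 2 * exp (- s / 2) * normal_density 0 1 x"
      using True by (intro mult_right_mono mult_left_mono) auto
    finally show ?thesis using True by simp
  qed simp
  have "{\<omega> \<in> space M. s < (X \<omega>)\<^sup>2} = X -` ?A \<inter> space M" by auto
  then have "emeasure M {\<omega> \<in> space M. s < (X \<omega>)\<^sup>2}
      = (\<integral>\<^sup>+x. ennreal (normal_density 0 (sqrt (1 / 2)) x) * indicator ?A x \<partial>lborel)"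
    using distributed_emeasure[OF D, of ?A] by simp
  also have "\<dots> \<le> (\<integral>\<^sup>+x. ennreal (sqrt 2 * exp (- s / 2)) * ennreal (normal_density 0 1 x) \<partial>lborel)"
  proof (intro nn_integral_mono)
    fix x
    show "ennreal (normal_density 0 (sqrt (1 / 2)) x) * indicator ?A x
        \<le> ennreal (sqrt 2 * exp (- s / 2)) * ennreal (normal_density 0 1 x)"
      using ennreal_leI[OF le[of x]]
      by (auto simp: ennreal_mult' split: split_indicator split_indicator_asm)
  qed
  also have "\<dots> = ennreal (sqrt 2 * exp (- s / 2)) * (\<integral>\<^sup>+x. ennreal (normal_density 0 1 x) \<partial>lborel)"
    by (intro nn_integral_cmult) auto
  also have "(\<integral>\<^sup>+x. ennreal (normal_density 0 1 x) \<partial>lborel) = 1"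
    by (subst nn_integral_eq_integral) auto
  finally show ?thesis by (simp add: emeasure_eq_measure)
qed

text \<open>The unit interval starting at \<open>sqrt t\<close> lies in the tail, and on it the
  density is at least the constant claimed, because there \<open>x\<^sup>2\<close> is at most
  \<open>2 * t + 2\<close>.\<close>

lemma (in prob_space) normal_variance_half_lower_tail:
  assumes D: "distributed M lborel X (normal_density 0 (sqrt (1 / 2)))" and t: "0 \<le> t"
  shows "exp (- 2 * t - 2) / sqrt pi \<le> prob {\<omega> \<in> space M. t \<le> (X \<omega>)\<^sup>2}"
proof -
  let ?A = "{x::real. t \<le> x\<^sup>2}"
  let ?c = "exp (- 2 * t - 2) / sqrt pi"
  define B where "B = {sqrt t..sqrt t + 1}"
  have [measurable]: "?A \<in> sets borel" "B \<in> sets borel" unfolding B_def by measurable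
  have le: "?c * indicator B x \<le> normal_density 0 (sqrt (1 / 2)) x * indicator ?A x" for x
  proof (cases "x \<in> B")
    case True
    have "0 \<le> sqrt t" using t by simp
    then have "(sqrt t)\<^sup>2 \<le> x\<^sup>2" using True[unfolded B_def] by (intro power_mono; simp)
    then have A: "x \<in> ?A" using t by simp
    have "0 \<le> x" using True[unfolded B_def] \<open>0 \<le> sqrt t\<close> by (metis atLeastAtMost_iff order_trans)
    then have "x\<^sup>2 \<le> (sqrt t + 1)\<^sup>2" using True[unfolded B_def] by (intro power_mono) auto
    \<comment> \<open>With \<open>a = sqrt t\<close>, the difference of the two sides is
      \<open>(a - 1)\<^sup>2\<close>.\<close>
    also have "\<dots> \<le> 2 * (sqrt t)\<^sup>2 + 2"
      using zero_le_power2[of "sqrt t - 1"] by (simp add: power2_eq_square algebra_simps)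
    also have "\<dots> = 2 * t + 2" using t by simp
    finally have "?c \<le> exp (- x\<^sup>2) / sqrt pi" by (intro divide_right_mono) auto
    also have "\<dots> = normal_density 0 (sqrt (1 / 2)) x" by (simp add: normal_density_def)
    finally show ?thesis using A True by simp
  qed simp
  have "ennreal ?c = ennreal ?c * emeasure lborel B" by (simp add: B_def)
  also have "\<dots> = (\<integral>\<^sup>+x. ennreal ?c * indicator B x \<partial>lborel)" by (subst nn_integral_cmult_indicator) auto
  also have "\<dots> \<le> (\<integral>\<^sup>+x. ennreal (normal_density 0 (sqrt (1 / 2)) x) * indicator ?A x \<partial>lborel)"
  proof (intro nn_integral_mono)
    fix x
    show "ennreal ?c * indicator B x
        \<le> ennreal (normal_density 0 (sqrt (1 / 2)) x) * indicator ?A x"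
      using ennreal_leI[OF le[of x]]
      by (cases "x \<in> B"; cases "x \<in> ?A") (auto simp: divide_le_0_iff not_le[THEN iffD2, OF pi_gt_zero])
  qed
  also have "\<dots> = emeasure M {\<omega> \<in> space M. t \<le> (X \<omega>)\<^sup>2}"
  proof -
    have "{\<omega> \<in> space M. t \<le> (X \<omega>)\<^sup>2} = X -` ?A \<inter> space M" by auto
    then show ?thesis using distributed_emeasure[OF D, of ?A] by simp
  qed
  finally show ?thesis by (simp add: emeasure_eq_measure)
qed

text \<open>If the squared modulus exceeds \<open>s\<close>, the square of the real or of the
  imaginary part exceeds \<open>s / 2\<close>; a union bound over the two gives the factor
  2.\<close>

lemma (in prob_space) std_complex_gaussian_upper_tail:
  assumes "std_complex_gaussian M Z"
  shows "prob {\<omega> \<in> space M. s < (cmod (Z \<omega>))\<^sup>2} \<le> 2 * sqrt 2 * exp (- s / 4)"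
proof -
  have [measurable]: "Z \<in> borel_measurable M"
    and D: "distributed M lborel (\<lambda>\<omega>. Re (Z \<omega>)) (normal_density 0 (sqrt (1 / 2)))"
    "distributed M lborel (\<lambda>\<omega>. Im (Z \<omega>)) (normal_density 0 (sqrt (1 / 2)))"
    using assms unfolding std_complex_gaussian_def by auto
  let ?R = "{\<omega> \<in> space M. s / 2 < (Re (Z \<omega>))\<^sup>2}" and ?I = "{\<omega> \<in> space M. s / 2 < (Im (Z \<omega>))\<^sup>2}"
  have "prob {\<omega> \<in> space M. s < (cmod (Z \<omega>))\<^sup>2} \<le> prob (?R \<union> ?I)"
    by (intro finite_measure_mono) (auto simp: cmod_power2)
  also have "\<dots> \<le> prob ?R + prob ?I" by (intro measure_Un_le) auto
  also have "\<dots> \<le> sqrt 2 * exp (- (s / 2) / 2) + sqrt 2 * exp (- (s / 2) / 2)"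
    by (intro add_mono normal_variance_half_upper_tail D)
  finally show ?thesis by simp
qed

text \<open>The squared modulus dominates the square of the real part, so the real lower tail
  carries over. The complement is the form that the greedy matching takes as
  \<open>q\<close>.\<close>

lemma (in prob_space) std_complex_gaussian_lower_tail:
  assumes "std_complex_gaussian M Z" and t: "0 \<le> t"
  shows "prob {\<omega> \<in> space M. \<not> t \<le> (cmod (Z \<omega>))\<^sup>2} \<le> 1 - exp (- 2 * t - 2) / sqrt pi"
proof -
  have [measurable]: "Z \<in> borel_measurable M"
    and D: "distributed M lborel (\<lambda>\<omega>. Re (Z \<omega>)) (normal_density 0 (sqrt (1 / 2)))"
    using assms unfolding std_complex_gaussian_def by auto
  have "exp (- 2 * t - 2) / sqrt pi \<le> prob {\<omega> \<in> space M. t \<le> (Re (Z \<omega>))\<^sup>2}"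
    by (rule normal_variance_half_lower_tail[OF D t])
  also have "\<dots> \<le> prob {\<omega> \<in> space M. t \<le> (cmod (Z \<omega>))\<^sup>2}"
    by (intro finite_measure_mono) (auto simp: cmod_power2 intro: order_trans)
  finally show ?thesis by (subst prob_neg) auto
qed

section \<open>Bounds on the maximal sum rate\<close>

text \<open>The even positions receive the matched users. The odd positions and the remaining users
  both number \<open>M\<close>, so any bijection \<open>g\<close> between them completes the
  permutation.\<close>

lemma pairing_extending_injection:
  assumes f: "inj_on f {1..M}" "f ` {1..M} \<subseteq> {1..2 * M}"
  shows "\<exists>l\<in>pairings M. \<forall>m\<in>{1..M}. l (2 * m) = f m"
proof -
  let ?U = "{1..2 * M}" and ?E = "(\<lambda>m. 2 * m) ` {1..M}"
  have E: "?E \<subseteq> ?U" "card ?E = M" by (auto simp: card_image inj_on_def)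
  have "card (?U - ?E) = card (?U - f ` {1..M})"
    using E f by (simp add: card_Diff_subset card_image)
  then obtain g where g: "bij_betw g (?U - ?E) (?U - f ` {1..M})"
    by (metis finite_Diff finite_atLeastAtMost finite_same_card_bij)
  \<comment> \<open>The last branch is the identity because \<open>permutes\<close> demands fixed
    points outside the range.\<close>
  define l where "l x = (if x \<in> ?E then f (x div 2) else if x \<in> ?U then g x else x)" for x
  have "bij_betw (\<lambda>x. x div 2) ?E {1..M}"
    by (rule bij_betw_byWitness[where f' = "\<lambda>m. 2 * m"]) auto
  then have "bij_betw (f \<circ> (\<lambda>x. x div 2)) ?E (f ` {1..M})"
    using f(1) by (intro bij_betw_trans) (auto simp: bij_betw_def)
  then have "bij_betw l ?E (f ` {1..M})"
    by (rule bij_betw_cong[THEN iffD1, rotated]) (simp add: l_def)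
  moreover have "bij_betw l (?U - ?E) (?U - f ` {1..M})"
    using g by (rule bij_betw_cong[THEN iffD1, rotated]) (simp add: l_def)
  ultimately have "bij_betw l (?E \<union> (?U - ?E)) (f ` {1..M} \<union> (?U - f ` {1..M}))"
    by (rule bij_betw_combine) auto
  then have "bij_betw l ?U ?U" using E f by (simp add: Un_absorb1)
  moreover have "l x = x" if "x \<notin> ?U" for x
    using that E(1) unfolding l_def by (metis subsetD)
  ultimately have "l permutes ?U" by (rule bij_imp_permutes)
  moreover have "\<forall>m\<in>{1..M}. l (2 * m) = f m" by (auto simp: l_def)
  ultimately show ?thesis unfolding pairings_def by blast
qed

text \<open>The bound is uniform over all pairings; the factor 2 comes from the two users that share
  a subcarrier, each contributing at most \<open>c2 * s\<close>.\<close>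

lemma max_sum_rate_upper:
  assumes g: "\<And>i. i \<in> {1..2 * M} \<Longrightarrow> 0 \<le> \<gamma> i \<and> \<gamma> i \<le> c2"
    and H: "\<And>i m. i \<in> {1..2 * M} \<Longrightarrow> m \<in> {1..M} \<Longrightarrow> (cmod (h i m))\<^sup>2 \<le> s"
  shows "max_sum_rate M \<gamma> h \<le> M * log 2 (1 + 2 * c2 * s)"
  unfolding max_sum_rate_def
proof (subst Max_le_iff)
  show "\<forall>a\<in>(\<lambda>l. \<Sum>m = 1..M. subcarrier_rate \<gamma> h m (l (2 * m - 1)) (l (2 * m))) ` pairings M.
    a \<le> M * log 2 (1 + 2 * c2 * s)"
  proof clarify
    fix l assume l: "l \<in> pairings M"
    have "subcarrier_rate \<gamma> h m (l (2 * m - 1)) (l (2 * m)) \<le> log 2 (1 + 2 * c2 * s)"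
      if m: "m \<in> {1..M}" for m
    proof -
      have "2 * m - 1 \<in> {1..2 * M}" "2 * m \<in> {1..2 * M}" using m by auto
      then have i: "l (2 * m - 1) \<in> {1..2 * M}" "l (2 * m) \<in> {1..2 * M}"
        using l unfolding pairings_def by (metis mem_Collect_eq permutes_in_image)+
      have "\<gamma> i * (cmod (h i m))\<^sup>2 \<le> c2 * s" "0 \<le> \<gamma> i * (cmod (h i m))\<^sup>2" if "i \<in> {1..2 * M}" for i
        using g[OF that] H[OF that m] by (auto intro!: mult_mono)
      from this[OF i(1)] this[OF i(2)] show ?thesis
        unfolding subcarrier_rate_def by (subst log_le_cancel_iff) auto
    qed
    then have "(\<Sum>m = 1..M. subcarrier_rate \<gamma> h m (l (2 * m - 1)) (l (2 * m)))
        \<le> (\<Sum>m = 1..M. log 2 (1 + 2 * c2 * s))" by (rule sum_mono)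
    then show "(\<Sum>m = 1..M. subcarrier_rate \<gamma> h m (l (2 * m - 1)) (l (2 * m)))
        \<le> M * log 2 (1 + 2 * c2 * s)" by simp
  qed
qed (auto simp: finite_pairings pairings_nonempty)

text \<open>One pairing suffices: extend \<open>f\<close> to a pairing. The user \<open>f m\<close>
  alone reaches the bound, and its partner only adds a nonnegative term inside the
  logarithm.\<close>

lemma max_sum_rate_lower:
  assumes g: "\<And>i. i \<in> {1..2 * M} \<Longrightarrow> c1 \<le> \<gamma> i" and c1: "0 \<le> c1" and t: "0 \<le> t"
    and f: "inj_on f {1..M}" "f ` {1..M} \<subseteq> {1..2 * M}"
      "\<And>m. m \<in> {1..M} \<Longrightarrow> t \<le> (cmod (h (f m) m))\<^sup>2"
  shows "M * log 2 (1 + c1 * t) \<le> max_sum_rate M \<gamma> h"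
proof -
  obtain l where l: "l \<in> pairings M" "\<forall>m\<in>{1..M}. l (2 * m) = f m"
    using pairing_extending_injection[OF f(1,2)] by blast
  have "log 2 (1 + c1 * t) \<le> subcarrier_rate \<gamma> h m (l (2 * m - 1)) (l (2 * m))"
    if m: "m \<in> {1..M}" for m
  proof -
    have "2 * m - 1 \<in> {1..2 * M}" using m by auto
    then have i: "l (2 * m - 1) \<in> {1..2 * M}"
      using l unfolding pairings_def by (metis mem_Collect_eq permutes_in_image)
    have "f m \<in> {1..2 * M}" using f(2) m by blast
    then have "c1 * t \<le> \<gamma> (f m) * (cmod (h (f m) m))\<^sup>2"
      using g f(3)[OF m] c1 t by (intro mult_mono) (auto intro: order_trans)
    moreover have "0 \<le> \<gamma> (l (2 * m - 1)) * (cmod (h (l (2 * m - 1)) m))\<^sup>2"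
      using g[OF i] c1 by simp
    moreover have "0 \<le> c1 * t" using c1 t by simp
    ultimately show ?thesis
      using l(2) m unfolding subcarrier_rate_def by (subst log_le_cancel_iff) auto
  qed
  then have "(\<Sum>m = 1..M. log 2 (1 + c1 * t))
      \<le> (\<Sum>m = 1..M. subcarrier_rate \<gamma> h m (l (2 * m - 1)) (l (2 * m)))" by (rule sum_mono)
  also have "\<dots> \<le> max_sum_rate M \<gamma> h"
    unfolding max_sum_rate_def using l(1) by (intro Max_ge finite_imageI finite_pairings) auto
  finally show ?thesis by simp
qed

section \<open>Asymptotics of the rate bounds and of the failure probabilities\<close>

text \<open>A constant factor inside the outer logarithm is only a bounded additive term, negligible
  against \<open>ln (ln M)\<close>. Hence neither the SNR bounds nor the tail constants affect the
  limit.\<close>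

lemma log_affine_ln_ratio:
  assumes "(0::real) < c"
  shows "(\<lambda>M. log 2 (1 + c * ln (real M)) / log 2 (ln (real M))) \<longlonglongrightarrow> 1"
  using assms unfolding log_def by real_asymp

text \<open>The exponential is \<open>M\<close> to the power -4, which beats the
  \<open>2 * M * M\<close> coefficients of the union bound.\<close>

lemma deviation_bound_vanishes:
  "(\<lambda>M. real (2 * M * M) * (2 * sqrt 2 * exp (- (16 * ln (real M)) / 4))) \<longlonglongrightarrow> 0"
  by real_asymp

text \<open>With \<open>c = exp (- 2) / sqrt pi\<close>, the subtracted term is
  \<open>c / sqrt M\<close>. By \<open>1 - x \<le> exp (- x)\<close> the power is at most
  \<open>exp (- c * sqrt M)\<close>, which beats the factor \<open>M\<close>.\<close>

lemma matching_bound_vanishes: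
  "(\<lambda>M. real M * (1 - exp (- 2 * (ln (real M) / 4) - 2) / sqrt pi) ^ M) \<longlonglongrightarrow> 0"
proof (rule tendsto_sandwich)
  define c where "c = exp (- 2) / sqrt pi"
  have c: "0 < c" "c \<le> 1"
  proof -
    show "0 < c" unfolding c_def by simp
    have "exp (- 2 :: real) \<le> 1" by simp
    also have "1 \<le> sqrt pi" using pi_gt3 by simp
    finally show "c \<le> 1" unfolding c_def using pi_gt_zero by (simp add: divide_le_eq)
  qed
  \<comment> \<open>The lower bound 0, which rests on \<open>c \<le> 1\<close>, makes taking the
    \<open>M\<close>-th power monotone.\<close>
  have q: "0 \<le> 1 - exp (- 2 * (ln (real M) / 4) - 2) / sqrt pi \<and>
     1 - exp (- 2 * (ln (real M) / 4) - 2) / sqrt pi \<le> exp (- c * exp (- ln (real M) / 2))"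
    if "M \<ge> 1" for M :: nat
  proof -
    have eq: "exp (- 2 * (ln (real M) / 4) - 2) / sqrt pi = c * exp (- ln (real M) / 2)"
      unfolding c_def by (simp flip: exp_add)
    have "c * exp (- ln (real M) / 2) \<le> 1 * 1" using c that by (intro mult_mono) auto
    then show ?thesis unfolding eq using exp_ge_add_one_self[of "- c * exp (- ln (real M) / 2)"] by simp
  qed
  show "\<forall>\<^sub>F M in sequentially. 0 \<le> real M * (1 - exp (- 2 * (ln (real M) / 4) - 2) / sqrt pi) ^ M"
    using eventually_ge_at_top[of 1] by eventually_elim (use q in auto)
  show "\<forall>\<^sub>F M in sequentially. real M * (1 - exp (- 2 * (ln (real M) / 4) - 2) / sqrt pi) ^ M
     \<le> real M * exp (- c * exp (- ln (real M) / 2)) ^ M"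
    using eventually_ge_at_top[of 1] by eventually_elim (use q in \<open>auto intro!: mult_left_mono power_mono\<close>)
  show "(\<lambda>M. real M * exp (- c * exp (- ln (real M) / 2)) ^ M) \<longlonglongrightarrow> 0"
    using c(1) unfolding exp_of_nat_mult[symmetric] by real_asymp
qed auto

section \<open>From tail bounds to convergence in probability\<close>

text \<open>All randomness is confined to one measurable exceptional event \<open>B\<close>; off
  \<open>B\<close> the rate bounds are deterministic. The thresholds \<open>s\<close> and
  \<open>t\<close> stay free until the limit is taken.\<close>

lemma (in prob_space) max_sum_rate_typical:
  fixes h :: "nat \<Rightarrow> nat \<Rightarrow> 'a \<Rightarrow> complex"
  assumes c1: "0 \<le> c1" and t: "0 \<le> t"
    and \<gamma>: "\<And>i. i \<in> {1..2 * N} \<Longrightarrow> c1 \<le> \<gamma> i \<and> \<gamma> i \<le> c2"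
    and gauss: "\<And>i m. \<lbrakk>i \<in> {1..2 * N}; m \<in> {1..N}\<rbrakk> \<Longrightarrow> std_complex_gaussian M (h i m)"
    and ind: "indep_vars (\<lambda>_. borel) (\<lambda>(i, m). h i m) ({1..2 * N} \<times> {1..N})"
  obtains B where "B \<in> events"
    "prob B \<le> real (2 * N * N) * (2 * sqrt 2 * exp (- s / 4))
            + real N * (1 - exp (- 2 * t - 2) / sqrt pi) ^ N"
    "\<And>\<omega>. \<omega> \<in> space M - B \<Longrightarrow>
       real N * log 2 (1 + c1 * t) \<le> max_sum_rate N \<gamma> (\<lambda>i m. h i m \<omega>) \<and>
       max_sum_rate N \<gamma> (\<lambda>i m. h i m \<omega>) \<le> real N * log 2 (1 + 2 * c2 * s)"
proof -
  let ?I = "{1..2 * N}"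
  \<comment> \<open>The \<open>case\<close> form keeps \<open>G\<close> literally a function of the
    independent family, so independence transfers by composition.\<close>
  define G where "G p \<omega> \<longleftrightarrow> t \<le> (cmod ((case p of (i, m) \<Rightarrow> h i m) \<omega>))\<^sup>2" for p \<omega>
  define L where "L p = {\<omega> \<in> space M. s < (cmod ((case p of (i, m) \<Rightarrow> h i m) \<omega>))\<^sup>2}" for p
  define B1 where "B1 = (\<Union>p\<in>?I \<times> {1..N}. L p)"
  define B2 where "B2 = {\<omega> \<in> space M. \<not> matchable ?I N {x \<in> ?I \<times> {1..N}. G x \<omega>}}"
  have meas: "h i m \<in> borel_measurable M" if "i \<in> ?I" "m \<in> {1..N}" for i m
    using gauss[OF that] unfolding std_complex_gaussian_def by blast
  have L: "L p \<in> events" if "p \<in> ?I \<times> {1..N}" for p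
  proof -
    obtain i m where p: "p = (i, m)" by (cases p)
    have [measurable]: "h i m \<in> borel_measurable M" using that meas p by auto
    show ?thesis unfolding L_def p by simp
  qed
  then have B1: "B1 \<in> events" unfolding B1_def by (intro sets.finite_UN) auto
  have "prob B1 \<le> (\<Sum>p\<in>?I \<times> {1..N}. prob (L p))"
    unfolding B1_def using L by (intro measure_UNION_le) auto
  also have "\<dots> \<le> (\<Sum>p\<in>?I \<times> {1..N}. 2 * sqrt 2 * exp (- s / 4))"
  proof (rule sum_mono)
    fix p assume "p \<in> ?I \<times> {1..N}"
    then obtain i m where "p = (i, m)" "i \<in> ?I" "m \<in> {1..N}" by blast
    then show "prob (L p) \<le> 2 * sqrt 2 * exp (- s / 4)"
      unfolding L_def using std_complex_gaussian_upper_tail[OF gauss] by simp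
  qed
  also have "\<dots> = real (2 * N * N) * (2 * sqrt 2 * exp (- s / 4))"
    by (simp add: card_cartesian_product)
  finally have pB1: "prob B1 \<le> real (2 * N * N) * (2 * sqrt 2 * exp (- s / 4))" .
  have "indep_vars (\<lambda>_. count_space UNIV)
      (\<lambda>p \<omega>. t \<le> (cmod ((case p of (i, m) \<Rightarrow> h i m) \<omega>))\<^sup>2) (?I \<times> {1..N})"
    using ind by (rule indep_vars_compose2) measurable
  then have indG: "indep_vars (\<lambda>_. count_space UNIV) G (?I \<times> {1..N})"
    unfolding G_def .
  \<comment> \<open>Greedy matching with \<open>K = n = N\<close>: of the \<open>2 * N\<close>
    users, at least \<open>N\<close> are still free at each step.\<close>
  have B2: "B2 \<in> events \<and> prob B2 \<le> real N * (1 - exp (- 2 * t - 2) / sqrt pi) ^ N"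
    unfolding B2_def
  proof (rule prob_not_matchable[OF _ _ indG])
    show "prob {\<omega> \<in> space M. \<not> G x \<omega>} \<le> 1 - exp (- 2 * t - 2) / sqrt pi"
      if x: "x \<in> ?I \<times> {1..N}" for x
    proof -
      obtain i m where "x = (i, m)" "i \<in> ?I" "m \<in> {1..N}" using x by blast
      then show ?thesis
        unfolding G_def using std_complex_gaussian_lower_tail[OF gauss t] by simp
    qed
  qed auto
  show thesis
  proof
    show "B1 \<union> B2 \<in> events" using B1 B2 by blast
    have "prob (B1 \<union> B2) \<le> prob B1 + prob B2" using B1 B2 by (intro measure_Un_le) auto
    then show "prob (B1 \<union> B2) \<le> real (2 * N * N) * (2 * sqrt 2 * exp (- s / 4))
            + real N * (1 - exp (- 2 * t - 2) / sqrt pi) ^ N"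
      using pB1 B2 by linarith
    fix \<omega> assume \<omega>: "\<omega> \<in> space M - (B1 \<union> B2)"
    then obtain f where f: "inj_on f {1..N}" "f ` {1..N} \<subseteq> ?I" "\<forall>m\<in>{1..N}. G (f m, m) \<omega>"
      unfolding B2_def matchable_def by auto
    have "real N * log 2 (1 + c1 * t) \<le> max_sum_rate N \<gamma> (\<lambda>i m. h i m \<omega>)"
      using \<gamma> c1 t f unfolding G_def by (intro max_sum_rate_lower[where f = f]) auto
    moreover have "max_sum_rate N \<gamma> (\<lambda>i m. h i m \<omega>) \<le> real N * log 2 (1 + 2 * c2 * s)"
    proof (rule max_sum_rate_upper)
      show "0 \<le> \<gamma> i \<and> \<gamma> i \<le> c2" if "i \<in> ?I" for i
        using \<gamma>[OF that] c1 by simp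
      show "(cmod (h i m \<omega>))\<^sup>2 \<le> s" if "i \<in> ?I" "m \<in> {1..N}" for i m
        using \<omega> that unfolding B1_def L_def by force
    qed
    ultimately show "real N * log 2 (1 + c1 * t) \<le> max_sum_rate N \<gamma> (\<lambda>i m. h i m \<omega>) \<and>
       max_sum_rate N \<gamma> (\<lambda>i m. h i m \<omega>) \<le> real N * log 2 (1 + 2 * c2 * s)" by blast
  qed
qed

theorem theorem1:
  fixes P :: "nat \<Rightarrow> 'a measure"
    and h :: "nat \<Rightarrow> nat \<Rightarrow> nat \<Rightarrow> 'a \<Rightarrow> complex"
    and \<gamma> :: "nat \<Rightarrow> nat \<Rightarrow> real"
    and c1 c2 :: real
  assumes "0 < c1" and "c1 \<le> c2"
    and "\<And>M i. \<lbrakk>M \<ge> 3; i \<in> {1..2 * M}\<rbrakk> \<Longrightarrow> c1 \<le> \<gamma> M i \<and> \<gamma> M i \<le> c2"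
    and "\<And>M. M \<ge> 3 \<Longrightarrow> prob_space (P M)"
    and "\<And>M i m. \<lbrakk>M \<ge> 3; i \<in> {1..2 * M}; m \<in> {1..M}\<rbrakk> \<Longrightarrow>
           std_complex_gaussian (P M) (h M i m)"
    and "\<And>M. M \<ge> 3 \<Longrightarrow>
           prob_space.indep_vars (P M) (\<lambda>_. borel) (\<lambda>(i, m). h M i m) ({1..2 * M} \<times> {1..M})"
  shows "tendsto_in_prob P
           (\<lambda>M \<omega>. max_sum_rate M (\<gamma> M) (\<lambda>i m. h M i m \<omega>) / (real M * log 2 (ln (real M)))) 1"
  unfolding tendsto_in_prob_def
proof (intro allI impI)
  fix \<epsilon> :: real assume \<epsilon>: "0 < \<epsilon>"
  define X where "X M \<omega> = max_sum_rate M (\<gamma> M) (\<lambda>i m. h M i m \<omega>)" for M \<omega>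
  define d where "d M = real M * log 2 (ln (real M))" for M
  define bnd where "bnd M = real (2 * M * M) * (2 * sqrt 2 * exp (- (16 * ln (real M)) / 4))
    + real M * (1 - exp (- 2 * (ln (real M) / 4) - 2) / sqrt pi) ^ M" for M
  \<comment> \<open>\<open>bnd\<close> is the failure probability for the thresholds
    \<open>s = 16 * ln M\<close> and \<open>t = ln M / 4\<close>.\<close>
  have bnd: "bnd \<longlonglongrightarrow> 0"
    unfolding bnd_def
    using tendsto_add[OF deviation_bound_vanishes matching_bound_vanishes] by simp
  \<comment> \<open>The constants \<open>c1 / 4\<close> here and \<open>32 * c2\<close> below are
    \<open>c1 * t\<close> and \<open>2 * c2 * s\<close> divided by \<open>ln M\<close>.\<close>
  have "(\<lambda>M. log 2 (1 + c1 / 4 * ln (real M)) / log 2 (ln (real M))) \<longlonglongrightarrow> 1"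
    using \<open>0 < c1\<close> by (intro log_affine_ln_ratio) auto
  then have lo: "\<forall>\<^sub>F M in sequentially.
      1 - \<epsilon> < log 2 (1 + c1 / 4 * ln (real M)) / log 2 (ln (real M))"
    using \<epsilon> by (intro order_tendstoD) auto
  have "(\<lambda>M. log 2 (1 + 32 * c2 * ln (real M)) / log 2 (ln (real M))) \<longlonglongrightarrow> 1"
    using \<open>0 < c1\<close> \<open>c1 \<le> c2\<close> by (intro log_affine_ln_ratio) auto
  then have hi: "\<forall>\<^sub>F M in sequentially.
      log 2 (1 + 32 * c2 * ln (real M)) / log 2 (ln (real M)) < 1 + \<epsilon>"
    using \<epsilon> by (intro order_tendstoD) auto
  have pos: "\<forall>\<^sub>F M in sequentially. 0 < log 2 (ln (real M))"
    by real_asymp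
  have "\<forall>\<^sub>F M in sequentially.
      measure (P M) {\<omega> \<in> space (P M). \<bar>X M \<omega> / d M - 1\<bar> > \<epsilon>} \<le> bnd M"
    using lo hi pos eventually_ge_at_top[of 3]
  proof eventually_elim
    fix M :: nat
    assume lo: "1 - \<epsilon> < log 2 (1 + c1 / 4 * ln (real M)) / log 2 (ln (real M))"
      and hi: "log 2 (1 + 32 * c2 * ln (real M)) / log 2 (ln (real M)) < 1 + \<epsilon>"
      and pos: "0 < log 2 (ln (real M))" and M: "3 \<le> M"
    interpret prob_space "P M" using assms(4)[OF M] .
    have t: "0 \<le> ln (real M) / 4" using M by simp
    obtain B where B: "B \<in> events" "prob B \<le> bnd M"
      and XB: "\<And>\<omega>. \<omega> \<in> space (P M) - B \<Longrightarrow>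
        real M * log 2 (1 + c1 * (ln (real M) / 4)) \<le> X M \<omega> \<and>
        X M \<omega> \<le> real M * log 2 (1 + 2 * c2 * (16 * ln (real M)))"
      unfolding X_def bnd_def
      by (rule max_sum_rate_typical[OF less_imp_le[OF assms(1)] t assms(3)[OF M] assms(5)[OF M]
          assms(6)[OF M], where s = "16 * ln (real M)"]) blast+
    have d: "0 < d M" unfolding d_def using pos M by simp
    have "\<bar>X M \<omega> / d M - 1\<bar> \<le> \<epsilon>" if "\<omega> \<in> space (P M) - B" for \<omega>
    proof -
      have "log 2 (1 + c1 / 4 * ln (real M)) / log 2 (ln (real M))
          = real M * log 2 (1 + c1 * (ln (real M) / 4)) / d M"
        unfolding d_def using M by simp
      also have "\<dots> \<le> X M \<omega> / d M" using XB[OF that] d by (intro divide_right_mono) auto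
      finally have 1: "1 - \<epsilon> < X M \<omega> / d M" using lo by simp
      have "X M \<omega> / d M \<le> real M * log 2 (1 + 2 * c2 * (16 * ln (real M))) / d M"
        using XB[OF that] d by (intro divide_right_mono) auto
      also have "\<dots> = log 2 (1 + 32 * c2 * ln (real M)) / log 2 (ln (real M))"
        unfolding d_def using M by (simp add: mult_ac)
      finally show ?thesis using 1 hi by simp
    qed
    \<comment> \<open>Large deviations can occur only on the exceptional event, whose probability is
      at most \<open>bnd M\<close>.\<close>
    then have "{\<omega> \<in> space (P M). \<bar>X M \<omega> / d M - 1\<bar> > \<epsilon>} \<subseteq> B" by force
    then have "prob {\<omega> \<in> space (P M). \<bar>X M \<omega> / d M - 1\<bar> > \<epsilon>} \<le> prob B"
      using B by (intro finite_measure_mono)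
    then show "measure (P M) {\<omega> \<in> space (P M). \<bar>X M \<omega> / d M - 1\<bar> > \<epsilon>} \<le> bnd M"
      using B by linarith
  qed
  then have "(\<lambda>M. measure (P M) {\<omega> \<in> space (P M). \<bar>X M \<omega> / d M - 1\<bar> > \<epsilon>}) \<longlonglongrightarrow> 0"
    by (rule tendsto_sandwich[OF _ _ tendsto_const bnd, rotated]) simp
  then show "(\<lambda>M. measure (P M) {\<omega> \<in> space (P M).
      \<bar>max_sum_rate M (\<gamma> M) (\<lambda>i m. h M i m \<omega>) / (real M * log 2 (ln (real M))) - 1\<bar> > \<epsilon>})
      \<longlonglongrightarrow> 0"
    unfolding X_def d_def .
qed

end
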